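(* Let $m,n,d\ge 1$ be integers, let $r<\min\{m,n\}$ be a nonnegative integer, let $A_1,\dots,A_d\in\mathbb{R}^{m\times n}$, and let $\mathcal{A}:\mathbb{R}^{m\times n}\to\mathbb{R}^d$, $\mathcal{A}(X)=(\langle A_1,X\rangle,\dots,\langle A_d,X\rangle)^\top$. Let $b\in\mathbb{R}^d$ be a noiseless measurement, i.e. $b=\mathcal{A}(X_\star)$ for some $X_\star\in\mathbb{R}^{m\times n}$ with $\operatorname{rank}(X_\star)\le r$. Put $L=2\sum_{i=1}^d\|A_i\|_F^2$ and let $\mu>0$, $\mu>2L$. Suppose that the rank-constrained matrix sensing problem $$\min_{X\in\mathbb{R}^{m\times n}}\|\mathcal{A}(X)-b\|_2^2\quad\text{s.t.}\quad \operatorname{rank}(X)\le r$$ has a unique solution. Let $(\bar Y,\bar X,\bar\Lambda)$ be the KKT point of the problem $$\min_{X,Y\in\mathbb{R}^{m\times n}}\ \|\mathcal{A}(X)-b\|_2^2+\delta_{\mathcal{C}}(Y)\quad\text{s.t.}\quad X-Y=0,\qquad \mathcal{C}=\{X\in\mathbb{R}^{m\times n}:\operatorname{rank}(X)\le r\},$$ to which the sequence $\{(Y^k,X^k,\Lambda^k)\}$ generated by the algorithm RCMS-ADMM (defined in the context) converges. Then $(\bar X,\bar Y)$ is the unique solution of this latter problem if and only if $\Lambda^k\to 0$.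
   Context: $\langle\cdot,\cdot\rangle$ is the Frobenius inner product of matrices and $\|\cdot\|_F$ the Frobenius norm. The indicator function $\delta_{\mathcal{C}}$ is $0$ on $\mathcal{C}$ and $+\infty$ off $\mathcal{C}$. The adjoint of $\mathcal{A}$ is $\mathcal{A}^*(w)=\sum_{i=1}^d w_iA_i$ for $w\in\mathbb{R}^d$. The two optimization problems are reformulations of each other: $X$ solves the first iff $(X,X)$ solves the second. Algorithm RCMS-ADMM (run without a stopping criterion): given $X^0,\Lambda^0\in\mathbb{R}^{m\times n}$ and $\mu>0$, for $k=0,1,2,\dots$: (1) $Y^{k+1}=\mathcal{P}_{\mathcal{C}}(X^k+\Lambda^k/\mu)$, a Frobenius-norm projection onto $\mathcal{C}$ given by truncated SVD: take an SVD $X^k+\Lambda^k/\mu=U\Sigma V^\top$ and set $Y^{k+1}=U\Sigma_rV^\top$, where $\Sigma_r$ is obtained from $\Sigma$ by setting all but the $r$ largest diagonal entries to $0$; (2) $X^{k+1}$ is the unique solution of $(2\mathcal{A}^*\mathcal{A}+\mu I)(X^{k+1})=2\mathcal{A}^*(b)+\mu Y^{k+1}-\Lambda^k$, with $I$ the identity map (equivalently, $X^{k+1}$ minimizes $\|\mathcal{A}(X)-b\|_2^2+\langle\Lambda^k,X-Y^{k+1}\rangle+\frac{\mu}{2}\|X-Y^{k+1}\|_F^2$ over $X$); (3) $\Lambda^{k+1}=\Lambda^k+\mu(X^{k+1}-Y^{k+1})$. A triple $(\bar Y,\bar X,\bar\Lambda)$ is a KKT point of the second problem if $2\mathcal{A}^*(\mathcal{A}(\bar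 X)-b)+\bar\Lambda=0$, $\ 0\in\partial\delta_{\mathcal{C}}(\bar Y)-\bar\Lambda$, and $\bar X-\bar Y=0$. Here $\partial$ is the limiting (Mordukhovich) subdifferential, so $\partial\delta_{\mathcal{C}}(\bar Y)$ is the limiting normal cone of $\mathcal{C}$ at $\bar Y$. The paper takes the convergence of the sequence to a KKT point as already established. *)

theory Defs
  imports "HOL-Analysis.Analysis"
begin

text \<open>
  Real \<open>m \<times> n\<close> matrices are elements of the type \<open>real^'n^'m\<close>, with \<open>m = CARD('m)\<close> and
  \<open>n = CARD('n)\<close>.  On this type the library's \<open>(\<bullet>)\<close> and \<open>norm\<close> are the Frobenius inner product
  and the Frobenius norm.
\<close>

definition measurement :: "('d \<Rightarrow> real^'n^'m) \<Rightarrow> real^'n^'m \<Rightarrow> real^'d" where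
  "measurement A X = (\<chi> i. A i \<bullet> X)"

definition measurement_adj :: "('d::finite \<Rightarrow> real^'n^'m) \<Rightarrow> real^'d \<Rightarrow> real^'n^'m" where
  "measurement_adj A w = (\<Sum>i\<in>UNIV. w $ i *\<^sub>R A i)"

definition low_rank :: "nat \<Rightarrow> (real^'n^'m) set" where
  "low_rank r = {X. rank X \<le> r}"

definition indicator_fun :: "'a set \<Rightarrow> 'a \<Rightarrow> ereal" where
  "indicator_fun C x = (if x \<in> C then 0 else \<infinity>)"

definition sensing_solutions ::
    "('d::finite \<Rightarrow> real^'n^'m) \<Rightarrow> real^'d \<Rightarrow> nat \<Rightarrow> (real^'n^'m) set" where
  "sensing_solutions A b r =
     {X. is_arg_min (\<lambda>X. (norm (measurement A X - b))\<^sup>2) (\<lambda>X. rank X \<le> r) X}"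

definition split_solutions ::
    "('d::finite \<Rightarrow> real^'n^'m) \<Rightarrow> real^'d \<Rightarrow> nat \<Rightarrow> ((real^'n^'m) \<times> (real^'n^'m)) set" where
  "split_solutions A b r =
     {Z. is_arg_min
           (\<lambda>(X, Y). ereal ((norm (measurement A X - b))\<^sup>2) + indicator_fun (low_rank r) Y)
           (\<lambda>(X, Y). X - Y = 0) Z}"


text \<open>
  The regular (Frechet) and the limiting (Mordukhovich) subdifferential of an extended-real-valued
  function; both are empty at points where the function is not finite.
\<close>

definition regular_subdiff :: "('a::euclidean_space \<Rightarrow> ereal) \<Rightarrow> 'a \<Rightarrow> 'a set" where
  "regular_subdiff f x =
     {v. \<bar>f x\<bar> \<noteq> \<infinity> \<and>
         0 \<le> Liminf (at x) (\<lambda>y. (f y - f x - ereal (v \<bullet> (y - x))) / ereal (norm (y - x)))}"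

definition limiting_subdiff :: "('a::euclidean_space \<Rightarrow> ereal) \<Rightarrow> 'a \<Rightarrow> 'a set" where
  "limiting_subdiff f x =
     {v. \<bar>f x\<bar> \<noteq> \<infinity> \<and>
         (\<exists>xs vs. xs \<longlonglongrightarrow> x \<and> (\<lambda>k. f (xs k)) \<longlonglongrightarrow> f x \<and> vs \<longlonglongrightarrow> v \<and>
                  (\<forall>k. vs k \<in> regular_subdiff f (xs k)))}"

definition kkt_point ::
    "('d::finite \<Rightarrow> real^'n^'m) \<Rightarrow> real^'d \<Rightarrow> nat \<Rightarrow>
     real^'n^'m \<Rightarrow> real^'n^'m \<Rightarrow> real^'n^'m \<Rightarrow> bool" where
  "kkt_point A b r Y X \<Lambda> \<longleftrightarrow>
     2 *\<^sub>R measurement_adj A (measurement A X - b) + \<Lambda> = 0 \<and>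
     0 \<in> (\<lambda>v. v - \<Lambda>) ` limiting_subdiff (indicator_fun (low_rank r)) Y \<and>
     X - Y = 0"


text \<open>
  A finite index type carries no order, so ``diagonal'' for rectangular matrices refers to a fixed
  numbering of the indices by \<open>0, ..., card - 1\<close>.  The choice of the numbering is immaterial for
  the truncated SVD, since permutation matrices can be absorbed into \<open>U\<close> and \<open>V\<close>.
\<close>

definition pos :: "'a::finite \<Rightarrow> nat" where
  "pos = to_nat_on (UNIV :: 'a set)"

definition is_svd ::
    "real^'n^'m \<Rightarrow> real^'m^'m \<Rightarrow> real^'n^'m \<Rightarrow> real^'n^'n \<Rightarrow> bool" where
  "is_svd M U S V \<longleftrightarrow>
     orthogonal_matrix U \<and> orthogonal_matrix V \<and>
     (\<forall>i j. 0 \<le> S $ i $ j) \<and> (\<forall>i j. pos i \<noteq> pos j \<longrightarrow> S $ i $ j = 0) \<and>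
     M = U ** S ** transpose V"

text \<open>
  \<open>K\<close> is the set of kept diagonal positions.  It need not be determined by \<open>S\<close>: ties may be broken
  arbitrarily.  The diagonal of \<open>S\<close> is not required to be sorted.
\<close>

definition keeps_largest :: "nat \<Rightarrow> real^'n^'m \<Rightarrow> real^'n^'m \<Rightarrow> bool" where
  "keeps_largest r S T \<longleftrightarrow>
     (\<exists>K. K \<subseteq> {..<min CARD('m) CARD('n)} \<and> card K = r \<and>
        (\<forall>i j i' j'. pos i = pos j \<and> pos i \<in> K \<and> pos i' = pos j' \<and> pos i' \<notin> K
            \<longrightarrow> S $ i' $ j' \<le> S $ i $ j) \<and>
        T = (\<chi> i j. if pos i = pos j \<and> pos i \<in> K then S $ i $ j else 0))"

definition is_truncated_svd :: "nat \<Rightarrow> real^'n^'m \<Rightarrow> real^'n^'m \<Rightarrow> bool" where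
  "is_truncated_svd r M Y \<longleftrightarrow>
     (\<exists>U S V T. is_svd M U S V \<and> keeps_largest r S T \<and> Y = U ** T ** transpose V)"

text \<open>
  Neither the SVD nor the truncation is unique, so the algorithm is a relation on sequences;
  \<open>Y 0\<close> plays no role.  The linear system for \<open>X (Suc k)\<close> is uniquely solvable when \<open>\<mu> > 0\<close>, so the
  equation determines \<open>X (Suc k)\<close>.
\<close>

definition rcms_admm ::
    "('d::finite \<Rightarrow> real^'n^'m) \<Rightarrow> real^'d \<Rightarrow> nat \<Rightarrow> real \<Rightarrow>
     (nat \<Rightarrow> real^'n^'m) \<Rightarrow> (nat \<Rightarrow> real^'n^'m) \<Rightarrow> (nat \<Rightarrow> real^'n^'m) \<Rightarrow> bool" where
  "rcms_admm A b r \<mu> Y X \<Lambda> \<longleftrightarrow>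
     (\<forall>k. is_truncated_svd r (X k + (1 / \<mu>) *\<^sub>R \<Lambda> k) (Y (Suc k)) \<and>
          2 *\<^sub>R measurement_adj A (measurement A (X (Suc k))) + \<mu> *\<^sub>R X (Suc k)
            = 2 *\<^sub>R measurement_adj A b + \<mu> *\<^sub>R Y (Suc k) - \<Lambda> k \<and>
          \<Lambda> (Suc k) = \<Lambda> k + \<mu> *\<^sub>R (X (Suc k) - Y (Suc k)))"

end

theory Submission
  imports Defs
begin

text \<open>
  Noiseless data make the optimal value zero, so the solutions of the split problem are exactly the
  pairs \<open>(X, X)\<close> with \<open>X\<close> of rank at most \<open>r\<close> that fits the data.  At a KKT point the multiplier is
  \<open>- 2 \<A>\<^sup>*(\<A> X - b)\<close>; since \<open>b\<close> lies in the range of \<open>\<A>\<close> and \<open>\<A>\<^sup>*\<close> is injective on that range, the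
  multiplier vanishes precisely when \<open>X\<close> fits the data.
\<close>

lemma measurement_diff: "measurement A (X - Z) = measurement A X - measurement A Z"
  by (simp add: measurement_def vec_eq_iff inner_diff_right)

lemma inner_measurement_adj: "measurement_adj A w \<bullet> X = w \<bullet> measurement A X"
  by (simp add: measurement_adj_def measurement_def inner_sum_left inner_vec_def[of w])

text \<open>For the residual \<open>w = measurement A (X - Z)\<close>, pairing
  \<open>measurement_adj A w\<close> with \<open>X - Z\<close> gives \<open>w \<bullet> w\<close>,
  so the adjoint can vanish at \<open>w\<close> only if \<open>w\<close> does.\<close>

lemma measurement_adj_residual_eq_0_iff:
  "measurement_adj A (measurement A X - measurement A Z) = 0 \<longleftrightarrow> measurement A X = measurement A Z"
proof
  assume "measurement_adj A (measurement A X - measurement A Z) = 0"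
  then have "(measurement A X - measurement A Z) \<bullet> measurement A (X - Z) = 0"
    by (metis inner_measurement_adj inner_zero_left)
  then show "measurement A X = measurement A Z"
    by (simp add: measurement_diff)
qed (simp add: measurement_adj_def)

text \<open>Limiting subgradients exist only where the function is finite. At a KKT point this turns
  the subgradient inclusion into the rank bound.\<close>

lemma limiting_subdiff_indicator_fun_imp_mem:
  "v \<in> limiting_subdiff (indicator_fun C) x \<Longrightarrow> x \<in> C"
  by (auto simp: limiting_subdiff_def indicator_fun_def split: if_splits)

lemma kkt_pointD:
  assumes "kkt_point A b r Y X \<Lambda>"
  shows "Y = X" "rank X \<le> r" "\<Lambda> = - 2 *\<^sub>R measurement_adj A (measurement A X - b)"
  using assms limiting_subdiff_indicator_fun_imp_mem[of _ "low_rank r" Y]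
  by (auto simp: kkt_point_def low_rank_def eq_neg_iff_add_eq_0 add.commute)

lemma sensing_solutions_noiseless:
  assumes "rank Z \<le> r" "b = measurement A Z"
  shows "sensing_solutions A b r = {X. rank X \<le> r \<and> measurement A X = b}"
proof -
  \<comment> \<open>\<open>Z\<close> is feasible with value 0, so a minimizer cannot leave a
    positive residual.\<close>
  have "measurement A X = b"
    if "is_arg_min (\<lambda>X. (norm (measurement A X - b))\<^sup>2) (\<lambda>X. rank X \<le> r) X" for X
    using that assms by (force simp: is_arg_min_def)
  then show ?thesis
    by (auto simp: sensing_solutions_def is_arg_min_def not_less)
qed

lemma split_solutions_eq:
  fixes A :: "'d::finite \<Rightarrow> real^'n^'m"
  shows "split_solutions A b r = (\<lambda>X. (X, X)) ` sensing_solutions A b r"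
proof -
  \<comment> \<open>The zero matrix gives a feasible pair of finite value. Without one, every pair
    \<open>(X, X)\<close> would have value \<infinity> and count as a minimizer.\<close>
  obtain Z :: "real^'n^'m" where "rank Z \<le> r"
    by (metis rank_0 le0)
  then have "(X, Y) \<in> split_solutions A b r \<longleftrightarrow> Y = X \<and> X \<in> sensing_solutions A b r" for X Y
    by (auto simp: split_solutions_def sensing_solutions_def is_arg_min_def indicator_fun_def
        low_rank_def not_less split: if_splits)
  then show ?thesis
    by auto
qed

theorem theorem6p2:
  fixes A :: "'d::finite \<Rightarrow> real^'n^'m"
    and b :: "real^'d"
    and r :: nat
    and L \<mu> :: real
    and X Y \<Lambda> :: "nat \<Rightarrow> real^'n^'m"
    and Xstar Xbar Ybar \<Lambda>bar :: "real^'n^'m"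
  assumes "r < min CARD('m) CARD('n)"
    and "rank Xstar \<le> r"
    and "b = measurement A Xstar"
    and "L = 2 * (\<Sum>i\<in>UNIV. (norm (A i))\<^sup>2)"
    and "\<mu> > 0"
    and "\<mu> > 2 * L"
    and "\<exists>!Z. Z \<in> sensing_solutions A b r"
    and "rcms_admm A b r \<mu> Y X \<Lambda>"
    and "kkt_point A b r Ybar Xbar \<Lambda>bar"
    and "Y \<longlonglongrightarrow> Ybar"
    and "X \<longlonglongrightarrow> Xbar"
    and "\<Lambda> \<longlonglongrightarrow> \<Lambda>bar"
  shows "split_solutions A b r = {(Xbar, Ybar)} \<longleftrightarrow> \<Lambda> \<longlonglongrightarrow> 0"
proof -
  note kkt = kkt_pointD[OF \<open>kkt_point A b r Ybar Xbar \<Lambda>bar\<close>]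
  note sol = sensing_solutions_noiseless[OF \<open>rank Xstar \<le> r\<close> \<open>b = measurement A Xstar\<close>]
  have "\<Lambda> \<longlonglongrightarrow> 0 \<longleftrightarrow> \<Lambda>bar = 0"
    using \<open>\<Lambda> \<longlonglongrightarrow> \<Lambda>bar\<close> LIMSEQ_unique by blast
  also have "\<dots> \<longleftrightarrow> measurement A Xbar = b"
    using kkt(3) measurement_adj_residual_eq_0_iff[of A Xbar Xstar] \<open>b = measurement A Xstar\<close>
    by simp
  also have "\<dots> \<longleftrightarrow> Xbar \<in> sensing_solutions A b r"
    using kkt(2) by (simp add: sol)
  \<comment> \<open>Here uniqueness of the solution enters: a member of the solution set is all of
    it.\<close>
  also have "\<dots> \<longleftrightarrow> sensing_solutions A b r = {Xbar}"
    using \<open>\<exists>!Z. Z \<in> sensing_solutions A b r\<close> by blast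
  \<comment> \<open>Since \<open>Ybar = Xbar\<close> and the diagonal map is injective, singletons
    correspond to singletons.\<close>
  also have "\<dots> \<longleftrightarrow> split_solutions A b r = {(Xbar, Ybar)}"
    unfolding split_solutions_eq kkt(1) by auto
  finally show ?thesis ..
qed

end
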